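(* Let $\mathbb{X}$ be a Cartesian differential category with differential combinator $\mathsf{D}$. For each object $C$, let $\mathsf{L}^C_{\mathsf{D}} := \mathsf{L}_{\mathsf{D}^C}$ be the linearizing combinator on the simple slice category $\mathbb{X}[C]$ induced by its differential combinator $\mathsf{D}^C$. Then the family $\mathsf{L}^C_{\mathsf{D}}$ is a system of linearizing combinators on $\mathbb{X}$. Equivalently, $\mathsf{L}^C_\mathsf{D}$ is given on a map $f: C\times A\to B$ by $$\mathsf{L}^{C}_{\mathsf{D}}[f] = \ell\, \mathsf{D}[f],\qquad \ell=\langle 1,0\rangle\times\langle 0,1\rangle: C\times A\to (C\times A)\times(C\times A).$$ Furthermore: (i) for every map $f: C \times A \to B$, $\mathsf{L}^{C}_\mathsf{D}[f]$ is linear in its second argument; (ii) a map $f: C \times A \to B$ is linear in its second argument if and only if $f$ is $\mathsf{L}^{C}_\mathsf{D}$-linear, i.e. $\mathsf{L}^C_\mathsf{D}[f]=f$; (iii) $\mathsf{L} = \mathsf{L}_\mathsf{D}$, where for $f:A\to B$, $\mathsf{L}[f]:=\langle 0,1\rangle\,\mathsf{L}_\mathsf{D}^\top[\pi_1 f]$ (with $\top$ the terminal object, $\pi_1:\top\times A\to A$, $\langle 0,1\rangle: A\to\top\times A$) and $\mathsf{L}_\mathsf{D}[f]:=\langle 0,1\rangle\,\mathsf{D}[f]$ (with $\langle 0,1\rangle:A\to A\times A$).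
   Context: Composition is in diagrammatic order: $fg$ means first $f$, then $g$; identities are written $1$. A left additive category is a category whose hom-sets are commutative monoids $(+,0)$ with $f(g+h)=fg+fh$ and $f0=0$. A map $f$ is additive if $0f=0$ and $(g+h)f=gf+hf$ for all $g,h$. A Cartesian left additive category is a left additive category with (chosen) finite products whose projections $\pi_0,\pi_1$ are additive; $\langle -,-\rangle$ is pairing, $f\times g=\langle \pi_0 f,\pi_1 g\rangle$, $\top$ is the terminal object. Put $\oplus_A:=\pi_0+\pi_1:A\times A\to A$; $\ell_{A,B,C,D}:=\langle 1,0\rangle\times\langle 0,1\rangle: A\times D\to (A\times B)\times(C\times D)$; $c_{A,B,C,D}:=\langle \pi_0\times\pi_0,\pi_1\times\pi_1\rangle:(A\times B)\times(C\times D)\to(A\times C)\times(B\times D)$ (subscripts omitted). A Cartesian differential category is a Cartesian left additive category $\mathbb{X}$ with a differential combinator $\mathsf{D}$, i.e. a family of operators $\mathsf{D}:\mathbb{X}(A,B)\to\mathbb{X}(A\times A,B)$ such that: [CD.1] $\mathsf{D}[f+g]=\mathsf{D}[f]+\mathsf{D}[g]$, $\mathsf{D}[0]=0$; [CD.2] $(1\times\oplus_A)\mathsf{D}[f]=(1\times\pi_0)\mathsf{D}[f]+(1\times\pi_1)\mathsf{D}[f]$, $\langle 1,0\rangle\mathsf{D}[f]=0$; [CD.3] $\mathsf{D}[1]=\pi_1$, $\mathsf{D}[\pi_0]=\pi_1\pi_0$, $\mathsf{D}[\pi_1]=\pi_1\pi_1$; [CD.4] $\mathsf{D}[\langle f,g\rangle]=\langle\mathsf{D}[f],\mathsf{D}[g]\rangle$;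 [CD.5] $\mathsf{D}[fg]=\langle\pi_0 f,\mathsf{D}[f]\rangle\mathsf{D}[g]$; [CD.6] $\ell\,\mathsf{D}[\mathsf{D}[f]]=\mathsf{D}[f]$; [CD.7] $c\,\mathsf{D}[\mathsf{D}[f]]=\mathsf{D}[\mathsf{D}[f]]$. The simple slice category $\mathbb{X}[C]$ has the objects of $\mathbb{X}$, hom-sets $\mathbb{X}[C](A,B)=\mathbb{X}(C\times A,B)$, identities $\pi_1:C\times A\to A$, and composite of $f:C\times A\to B$ and $g:C\times B\to D$ equal to $\langle\pi_0,f\rangle g$. It is Cartesian left additive with products of objects, pairing, sums and zeros as in $\mathbb{X}$ and projections $\pi_1\pi_0,\pi_1\pi_1$. If $\mathbb{X}$ is a Cartesian differential category it is known that $\mathbb{X}[C]$ is one too, with $\mathsf{D}^C[f]:=\langle 1\times\pi_0,0\times\pi_1\rangle\mathsf{D}[f]: C\times(A\times A)\to B$ for $f:C\times A\to B$. The induced linearizing combinator $\mathsf{L}_{\mathsf{D}^C}$ of $\mathbb{X}[C]$ is "$\langle 0,1\rangle\mathsf{D}[f]$" computed in $\mathbb{X}[C]$, i.e. $\mathsf{L}_{\mathsf{D}^C}[f]=\langle\pi_0,\langle 0,\pi_1\rangle\rangle\mathsf{D}^C[f]$. A map $f:C\times A\to B$ is linear in its second argument if $\mathsf{D}^C[f]=(1\times\pi_1)f$. A system of linearizing combinators on a Cartesian left additive category $\mathbb{X}$ is a family, indexed by objects $C$, of operators $\mathsf{L}^C:\mathbb{X}(C\times A,B)\to\mathbb{X}(C\times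 A,B)$ such that: [L.1] $\mathsf{L}^{C}[f+g]=\mathsf{L}^{C}[f]+\mathsf{L}^{C}[g]$, $\mathsf{L}^{C}[0]=0$; [L.2] $(1\times\oplus_A)\mathsf{L}^{C}[f]=(1\times\pi_0)\mathsf{L}^{C}[f]+(1\times\pi_1)\mathsf{L}^{C}[f]$, $\langle\pi_0,0\rangle\mathsf{L}^{C}[f]=0$; [L.3] $\mathsf{L}^{C}[\pi_1]=\pi_1$, $\mathsf{L}^{C}[\pi_1\pi_0]=\pi_1\pi_0$, $\mathsf{L}^{C}[\pi_1\pi_1]=\pi_1\pi_1$; [L.4] $\mathsf{L}^{C}[\langle f,g\rangle]=\langle\mathsf{L}^{C}[f],\mathsf{L}^{C}[g]\rangle$; [L.5] $\mathsf{L}^{C}[\langle\pi_0,f\rangle g]=\langle\pi_0,\mathsf{L}^{C}[f]\rangle\,\mathsf{L}^{C}[\langle\pi_0,\pi_1+\langle\pi_0,0\rangle f\rangle g]$; [L.6] $\mathsf{L}^{C}[\mathsf{L}^{C}[f]]=\mathsf{L}^{C}[f]$ ([L.1]-[L.6] say that $\mathsf{L}^C$ is a linearizing combinator on $\mathbb{X}[C]$); [L.7] with the isomorphisms $\alpha=\langle 1\times\pi_0,\pi_1\pi_1\rangle:C\times(A\times B)\to(C\times A)\times B$ and $\beta=\langle 1\times\pi_1,\pi_1\pi_0\rangle:C\times(A\times B)\to(C\times B)\times A$, and for $f:C\times(A\times B)\to D$, $\mathsf{L}^C_0[f]:=\beta\,\mathsf{L}^{C\times B}[\beta^{-1}f]$,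 $\mathsf{L}^C_1[f]:=\alpha\,\mathsf{L}^{C\times A}[\alpha^{-1}f]$, one has $\mathsf{L}^C_1[\mathsf{L}^C_0[f]]=\mathsf{L}^C_0[\mathsf{L}^C_1[f]]$; [L.8] for every $h:C'\to C$ and $f:C\times A\to B$, $(h\times 1)\mathsf{L}^{C}[f]=\mathsf{L}^{C'}[(h\times 1)f]$. *)

theory Defs
  imports Main
begin

text \<open>
  The objects of a category are all elements of a type and every hom-set is a set over one fixed
  type of arrows. Hom-sets need not be disjoint, so every operation on arrows takes the objects
  involved as arguments. In this way the hom-sets of the simple slice category are literally
  hom-sets of the base category. Composition \<open>comp X A B E f g\<close> is diagrammatic: first
  \<open>f : A \<rightarrow> B\<close>, then \<open>g : B \<rightarrow> E\<close>.
\<close>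

record ('o, 'm) cat =
  hom :: "'o \<Rightarrow> 'o \<Rightarrow> 'm set"
  ident :: "'o \<Rightarrow> 'm"
  comp :: "'o \<Rightarrow> 'o \<Rightarrow> 'o \<Rightarrow> 'm \<Rightarrow> 'm \<Rightarrow> 'm"

record ('o, 'm) add_cat = "('o, 'm) cat" +
  plus_arr :: "'o \<Rightarrow> 'o \<Rightarrow> 'm \<Rightarrow> 'm \<Rightarrow> 'm"
  zero_arr :: "'o \<Rightarrow> 'o \<Rightarrow> 'm"

text \<open>\<open>pair X Z A B f g\<close> is the pairing of \<open>f : Z \<rightarrow> A\<close> and \<open>g : Z \<rightarrow> B\<close>.\<close>

record ('o, 'm) cart_add_cat = "('o, 'm) add_cat" +
  prod_ob :: "'o \<Rightarrow> 'o \<Rightarrow> 'o" (infixl "\<otimes>\<index>" 70)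
  proj0 :: "'o \<Rightarrow> 'o \<Rightarrow> 'm"
  proj1 :: "'o \<Rightarrow> 'o \<Rightarrow> 'm"
  pair :: "'o \<Rightarrow> 'o \<Rightarrow> 'o \<Rightarrow> 'm \<Rightarrow> 'm \<Rightarrow> 'm"
  top_ob :: "'o"

locale category =
  fixes X :: "('o, 'm, 'z) cat_scheme" (structure)
  assumes ident_in_hom: "ident X A \<in> hom X A A"
    and comp_in_hom: "\<lbrakk>f \<in> hom X A B; g \<in> hom X B E\<rbrakk> \<Longrightarrow> comp X A B E f g \<in> hom X A E"
    and comp_ident_left: "f \<in> hom X A B \<Longrightarrow> comp X A A B (ident X A) f = f"
    and comp_ident_right: "f \<in> hom X A B \<Longrightarrow> comp X A B B f (ident X B) = f"
    and comp_assoc: "\<lbrakk>f \<in> hom X A B; g \<in> hom X B E; h \<in> hom X E F\<rbrakk>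
      \<Longrightarrow> comp X A E F (comp X A B E f g) h = comp X A B F f (comp X B E F g h)"

definition is_inverse :: "('o, 'm, 'z) cat_scheme \<Rightarrow> 'o \<Rightarrow> 'o \<Rightarrow> 'm \<Rightarrow> 'm \<Rightarrow> bool" where
  "is_inverse X A B f g \<longleftrightarrow>
     g \<in> hom X B A \<and> comp X A B A f g = ident X A \<and> comp X B A B g f = ident X B"

definition inverse_arr :: "('o, 'm, 'z) cat_scheme \<Rightarrow> 'o \<Rightarrow> 'o \<Rightarrow> 'm \<Rightarrow> 'm" where
  "inverse_arr X A B f = (THE g. is_inverse X A B f g)"

locale left_additive_category = category X
  for X :: "('o, 'm, 'z) add_cat_scheme" (structure) +
  assumes zero_in_hom: "zero_arr X A B \<in> hom X A B"
    and plus_in_hom: "\<lbrakk>f \<in> hom X A B; g \<in> hom X A B\<rbrakk> \<Longrightarrow> plus_arr X A B f g \<in> hom X A B"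
    and plus_assoc: "\<lbrakk>f \<in> hom X A B; g \<in> hom X A B; h \<in> hom X A B\<rbrakk>
      \<Longrightarrow> plus_arr X A B (plus_arr X A B f g) h = plus_arr X A B f (plus_arr X A B g h)"
    and plus_comm: "\<lbrakk>f \<in> hom X A B; g \<in> hom X A B\<rbrakk>
      \<Longrightarrow> plus_arr X A B f g = plus_arr X A B g f"
    and plus_zero: "f \<in> hom X A B \<Longrightarrow> plus_arr X A B f (zero_arr X A B) = f"
    and comp_plus: "\<lbrakk>f \<in> hom X A B; g \<in> hom X B E; h \<in> hom X B E\<rbrakk>
      \<Longrightarrow> comp X A B E f (plus_arr X B E g h)
          = plus_arr X A E (comp X A B E f g) (comp X A B E f h)"
    and comp_zero: "f \<in> hom X A B \<Longrightarrow> comp X A B E f (zero_arr X B E) = zero_arr X A E"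

definition additive :: "('o, 'm, 'z) add_cat_scheme \<Rightarrow> 'o \<Rightarrow> 'o \<Rightarrow> 'm \<Rightarrow> bool" where
  "additive X A B f \<longleftrightarrow>
     (\<forall>Z. comp X Z A B (zero_arr X Z A) f = zero_arr X Z B) \<and>
     (\<forall>Z. \<forall>g\<in>hom X Z A. \<forall>h\<in>hom X Z A.
        comp X Z A B (plus_arr X Z A g h) f
        = plus_arr X Z B (comp X Z A B g f) (comp X Z A B h f))"

locale cartesian_left_additive_category = left_additive_category X
  for X :: "('o, 'm, 'z) cart_add_cat_scheme" (structure) +
  assumes proj0_in_hom: "proj0 X A B \<in> hom X (A \<otimes> B) A"
    and proj1_in_hom: "proj1 X A B \<in> hom X (A \<otimes> B) B"
    and pair_in_hom: "\<lbrakk>f \<in> hom X Z A; g \<in> hom X Z B\<rbrakk> \<Longrightarrow> pair X Z A B f g \<in> hom X Z (A \<otimes> B)"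
    and pair_proj0: "\<lbrakk>f \<in> hom X Z A; g \<in> hom X Z B\<rbrakk>
      \<Longrightarrow> comp X Z (A \<otimes> B) A (pair X Z A B f g) (proj0 X A B) = f"
    and pair_proj1: "\<lbrakk>f \<in> hom X Z A; g \<in> hom X Z B\<rbrakk>
      \<Longrightarrow> comp X Z (A \<otimes> B) B (pair X Z A B f g) (proj1 X A B) = g"
    and pair_unique: "h \<in> hom X Z (A \<otimes> B)
      \<Longrightarrow> pair X Z A B (comp X Z (A \<otimes> B) A h (proj0 X A B)) (comp X Z (A \<otimes> B) B h (proj1 X A B)) = h"
    and top_terminal: "\<exists>!f. f \<in> hom X A (top_ob X)"
    and proj0_additive: "additive X (A \<otimes> B) A (proj0 X A B)"
    and proj1_additive: "additive X (A \<otimes> B) B (proj1 X A B)"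

text \<open>\<open>cross X A A' B B' f g\<close> is \<open>f \<times> g\<close> for \<open>f : A \<rightarrow> A'\<close> and \<open>g : B \<rightarrow> B'\<close>.\<close>

definition cross ::
  "('o, 'm, 'z) cart_add_cat_scheme \<Rightarrow> 'o \<Rightarrow> 'o \<Rightarrow> 'o \<Rightarrow> 'o \<Rightarrow> 'm \<Rightarrow> 'm \<Rightarrow> 'm" where
  "cross X A A' B B' f g =
     pair X (A \<otimes>\<^bsub>X\<^esub> B) A' B'
       (comp X (A \<otimes>\<^bsub>X\<^esub> B) A A' (proj0 X A B) f)
       (comp X (A \<otimes>\<^bsub>X\<^esub> B) B B' (proj1 X A B) g)"

definition inl :: "('o, 'm, 'z) cart_add_cat_scheme \<Rightarrow> 'o \<Rightarrow> 'o \<Rightarrow> 'm" where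
  "inl X A B = pair X A A B (ident X A) (zero_arr X A B)"

definition inr :: "('o, 'm, 'z) cart_add_cat_scheme \<Rightarrow> 'o \<Rightarrow> 'o \<Rightarrow> 'm" where
  "inr X A B = pair X B A B (zero_arr X B A) (ident X B)"

definition oplus :: "('o, 'm, 'z) cart_add_cat_scheme \<Rightarrow> 'o \<Rightarrow> 'm" where
  "oplus X A = plus_arr X (A \<otimes>\<^bsub>X\<^esub> A) A (proj0 X A A) (proj1 X A A)"

definition ell :: "('o, 'm, 'z) cart_add_cat_scheme \<Rightarrow> 'o \<Rightarrow> 'o \<Rightarrow> 'o \<Rightarrow> 'o \<Rightarrow> 'm" where
  "ell X A B E F = cross X A (A \<otimes>\<^bsub>X\<^esub> B) F (E \<otimes>\<^bsub>X\<^esub> F) (inl X A B) (inr X E F)"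

definition interchange :: "('o, 'm, 'z) cart_add_cat_scheme \<Rightarrow> 'o \<Rightarrow> 'o \<Rightarrow> 'o \<Rightarrow> 'o \<Rightarrow> 'm" where
  "interchange X A B E F =
     pair X ((A \<otimes>\<^bsub>X\<^esub> B) \<otimes>\<^bsub>X\<^esub> (E \<otimes>\<^bsub>X\<^esub> F)) (A \<otimes>\<^bsub>X\<^esub> E) (B \<otimes>\<^bsub>X\<^esub> F)
       (cross X (A \<otimes>\<^bsub>X\<^esub> B) A (E \<otimes>\<^bsub>X\<^esub> F) E (proj0 X A B) (proj0 X E F))
       (cross X (A \<otimes>\<^bsub>X\<^esub> B) B (E \<otimes>\<^bsub>X\<^esub> F) F (proj1 X A B) (proj1 X E F))"

text \<open>\<open>D A B f\<close> is the derivative of \<open>f : A \<rightarrow> B\<close>; values off the hom-sets are irrelevant.\<close>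

locale cartesian_differential_category = cartesian_left_additive_category X
  for X :: "('o, 'm, 'z) cart_add_cat_scheme" (structure) +
  fixes D :: "'o \<Rightarrow> 'o \<Rightarrow> 'm \<Rightarrow> 'm"
  assumes D_in_hom: "f \<in> hom X A B \<Longrightarrow> D A B f \<in> hom X (A \<otimes> A) B"
    and CD1_plus: "\<lbrakk>f \<in> hom X A B; g \<in> hom X A B\<rbrakk>
      \<Longrightarrow> D A B (plus_arr X A B f g) = plus_arr X (A \<otimes> A) B (D A B f) (D A B g)"
    and CD1_zero: "D A B (zero_arr X A B) = zero_arr X (A \<otimes> A) B"
    and CD2_plus: "f \<in> hom X A B
      \<Longrightarrow> comp X (A \<otimes> (A \<otimes> A)) (A \<otimes> A) B (cross X A A (A \<otimes> A) A (ident X A) (oplus X A)) (D A B f)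
          = plus_arr X (A \<otimes> (A \<otimes> A)) B
              (comp X (A \<otimes> (A \<otimes> A)) (A \<otimes> A) B
                 (cross X A A (A \<otimes> A) A (ident X A) (proj0 X A A)) (D A B f))
              (comp X (A \<otimes> (A \<otimes> A)) (A \<otimes> A) B
                 (cross X A A (A \<otimes> A) A (ident X A) (proj1 X A A)) (D A B f))"
    and CD2_zero: "f \<in> hom X A B \<Longrightarrow> comp X A (A \<otimes> A) B (inl X A A) (D A B f) = zero_arr X A B"
    and CD3_ident: "D A A (ident X A) = proj1 X A A"
    and CD3_proj0: "D (A \<otimes> B) A (proj0 X A B)
      = comp X ((A \<otimes> B) \<otimes> (A \<otimes> B)) (A \<otimes> B) A (proj1 X (A \<otimes> B) (A \<otimes> B)) (proj0 X A B)"
    and CD3_proj1: "D (A \<otimes> B) B (proj1 X A B)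
      = comp X ((A \<otimes> B) \<otimes> (A \<otimes> B)) (A \<otimes> B) B (proj1 X (A \<otimes> B) (A \<otimes> B)) (proj1 X A B)"
    and CD4: "\<lbrakk>f \<in> hom X Z A; g \<in> hom X Z B\<rbrakk>
      \<Longrightarrow> D Z (A \<otimes> B) (pair X Z A B f g) = pair X (Z \<otimes> Z) A B (D Z A f) (D Z B g)"
    and CD5: "\<lbrakk>f \<in> hom X A B; g \<in> hom X B E\<rbrakk>
      \<Longrightarrow> D A E (comp X A B E f g)
          = comp X (A \<otimes> A) (B \<otimes> B) E
              (pair X (A \<otimes> A) B B (comp X (A \<otimes> A) A B (proj0 X A A) f) (D A B f)) (D B E g)"
    and CD6: "f \<in> hom X A B
      \<Longrightarrow> comp X (A \<otimes> A) ((A \<otimes> A) \<otimes> (A \<otimes> A)) B (ell X A A A A) (D (A \<otimes> A) B (D A B f)) = D A B f"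
    and CD7: "f \<in> hom X A B
      \<Longrightarrow> comp X ((A \<otimes> A) \<otimes> (A \<otimes> A)) ((A \<otimes> A) \<otimes> (A \<otimes> A)) B (interchange X A A A A)
            (D (A \<otimes> A) B (D A B f))
          = D (A \<otimes> A) B (D A B f)"

definition slice ::
  "('o, 'm, 'z) cart_add_cat_scheme \<Rightarrow> 'o \<Rightarrow> ('o, 'm) cart_add_cat" where
  "slice X C =
     \<lparr> hom = (\<lambda>A B. hom X (C \<otimes>\<^bsub>X\<^esub> A) B),
       ident = (\<lambda>A. proj1 X C A),
       comp = (\<lambda>A B E f g. comp X (C \<otimes>\<^bsub>X\<^esub> A) (C \<otimes>\<^bsub>X\<^esub> B) E
                 (pair X (C \<otimes>\<^bsub>X\<^esub> A) C B (proj0 X C A) f) g),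
       plus_arr = (\<lambda>A B. plus_arr X (C \<otimes>\<^bsub>X\<^esub> A) B),
       zero_arr = (\<lambda>A B. zero_arr X (C \<otimes>\<^bsub>X\<^esub> A) B),
       prod_ob = prod_ob X,
       proj0 = (\<lambda>A B. comp X (C \<otimes>\<^bsub>X\<^esub> (A \<otimes>\<^bsub>X\<^esub> B)) (A \<otimes>\<^bsub>X\<^esub> B) A
                  (proj1 X C (A \<otimes>\<^bsub>X\<^esub> B)) (proj0 X A B)),
       proj1 = (\<lambda>A B. comp X (C \<otimes>\<^bsub>X\<^esub> (A \<otimes>\<^bsub>X\<^esub> B)) (A \<otimes>\<^bsub>X\<^esub> B) B
                  (proj1 X C (A \<otimes>\<^bsub>X\<^esub> B)) (proj1 X A B)),
       pair = (\<lambda>Z A B. pair X (C \<otimes>\<^bsub>X\<^esub> Z) A B),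
       top_ob = top_ob X \<rparr>"

definition slice_diff ::
  "('o, 'm, 'z) cart_add_cat_scheme \<Rightarrow> ('o \<Rightarrow> 'o \<Rightarrow> 'm \<Rightarrow> 'm) \<Rightarrow> 'o \<Rightarrow> 'o \<Rightarrow> 'o \<Rightarrow> 'm \<Rightarrow> 'm" where
  "slice_diff X D C A B f =
     comp X (C \<otimes>\<^bsub>X\<^esub> (A \<otimes>\<^bsub>X\<^esub> A)) ((C \<otimes>\<^bsub>X\<^esub> A) \<otimes>\<^bsub>X\<^esub> (C \<otimes>\<^bsub>X\<^esub> A)) B
       (pair X (C \<otimes>\<^bsub>X\<^esub> (A \<otimes>\<^bsub>X\<^esub> A)) (C \<otimes>\<^bsub>X\<^esub> A) (C \<otimes>\<^bsub>X\<^esub> A)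
          (cross X C C (A \<otimes>\<^bsub>X\<^esub> A) A (ident X C) (proj0 X A A))
          (cross X C C (A \<otimes>\<^bsub>X\<^esub> A) A (zero_arr X C C) (proj1 X A A)))
       (D (C \<otimes>\<^bsub>X\<^esub> A) B f)"

definition lin_of_diff ::
  "('o, 'm, 'z) cart_add_cat_scheme \<Rightarrow> ('o \<Rightarrow> 'o \<Rightarrow> 'm \<Rightarrow> 'm) \<Rightarrow> 'o \<Rightarrow> 'o \<Rightarrow> 'm \<Rightarrow> 'm" where
  "lin_of_diff X D A B f = comp X A (A \<otimes>\<^bsub>X\<^esub> A) B (inr X A A) (D A B f)"

definition slice_lin ::
  "('o, 'm, 'z) cart_add_cat_scheme \<Rightarrow> ('o \<Rightarrow> 'o \<Rightarrow> 'm \<Rightarrow> 'm) \<Rightarrow> 'o \<Rightarrow> 'o \<Rightarrow> 'o \<Rightarrow> 'm \<Rightarrow> 'm" where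
  "slice_lin X D C = lin_of_diff (slice X C) (slice_diff X D C)"

definition linear_in_second ::
  "('o, 'm, 'z) cart_add_cat_scheme \<Rightarrow> ('o \<Rightarrow> 'o \<Rightarrow> 'm \<Rightarrow> 'm) \<Rightarrow> 'o \<Rightarrow> 'o \<Rightarrow> 'o \<Rightarrow> 'm \<Rightarrow> bool" where
  "linear_in_second X D C A B f \<longleftrightarrow>
     slice_diff X D C A B f
     = comp X (C \<otimes>\<^bsub>X\<^esub> (A \<otimes>\<^bsub>X\<^esub> A)) (C \<otimes>\<^bsub>X\<^esub> A) B
         (cross X C C (A \<otimes>\<^bsub>X\<^esub> A) A (ident X C) (proj1 X A A)) f"

text \<open>\<open>alpha X C A B : C \<otimes> (A \<otimes> B) \<rightarrow> (C \<otimes> A) \<otimes> B\<close> and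
  \<open>beta X C A B : C \<otimes> (A \<otimes> B) \<rightarrow> (C \<otimes> B) \<otimes> A\<close>.\<close>

definition alpha :: "('o, 'm, 'z) cart_add_cat_scheme \<Rightarrow> 'o \<Rightarrow> 'o \<Rightarrow> 'o \<Rightarrow> 'm" where
  "alpha X C A B =
     pair X (C \<otimes>\<^bsub>X\<^esub> (A \<otimes>\<^bsub>X\<^esub> B)) (C \<otimes>\<^bsub>X\<^esub> A) B
       (cross X C C (A \<otimes>\<^bsub>X\<^esub> B) A (ident X C) (proj0 X A B))
       (comp X (C \<otimes>\<^bsub>X\<^esub> (A \<otimes>\<^bsub>X\<^esub> B)) (A \<otimes>\<^bsub>X\<^esub> B) B (proj1 X C (A \<otimes>\<^bsub>X\<^esub> B)) (proj1 X A B))"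

definition beta :: "('o, 'm, 'z) cart_add_cat_scheme \<Rightarrow> 'o \<Rightarrow> 'o \<Rightarrow> 'o \<Rightarrow> 'm" where
  "beta X C A B =
     pair X (C \<otimes>\<^bsub>X\<^esub> (A \<otimes>\<^bsub>X\<^esub> B)) (C \<otimes>\<^bsub>X\<^esub> B) A
       (cross X C C (A \<otimes>\<^bsub>X\<^esub> B) B (ident X C) (proj1 X A B))
       (comp X (C \<otimes>\<^bsub>X\<^esub> (A \<otimes>\<^bsub>X\<^esub> B)) (A \<otimes>\<^bsub>X\<^esub> B) A (proj1 X C (A \<otimes>\<^bsub>X\<^esub> B)) (proj0 X A B))"

text \<open>
  For \<open>f : C \<otimes> (A \<otimes> B) \<rightarrow> E\<close>, the partial linearizations in the first (\<open>A\<close>) and in the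
  second (\<open>B\<close>) component of \<open>A \<otimes> B\<close>.
\<close>

definition lin0 ::
  "('o, 'm, 'z) cart_add_cat_scheme \<Rightarrow> ('o \<Rightarrow> 'o \<Rightarrow> 'o \<Rightarrow> 'm \<Rightarrow> 'm)
     \<Rightarrow> 'o \<Rightarrow> 'o \<Rightarrow> 'o \<Rightarrow> 'o \<Rightarrow> 'm \<Rightarrow> 'm" where
  "lin0 X L C A B E f =
     (let S = C \<otimes>\<^bsub>X\<^esub> (A \<otimes>\<^bsub>X\<^esub> B); T = (C \<otimes>\<^bsub>X\<^esub> B) \<otimes>\<^bsub>X\<^esub> A; b = beta X C A B
      in comp X S T E b (L (C \<otimes>\<^bsub>X\<^esub> B) A E (comp X T S E (inverse_arr X S T b) f)))"

definition lin1 ::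
  "('o, 'm, 'z) cart_add_cat_scheme \<Rightarrow> ('o \<Rightarrow> 'o \<Rightarrow> 'o \<Rightarrow> 'm \<Rightarrow> 'm)
     \<Rightarrow> 'o \<Rightarrow> 'o \<Rightarrow> 'o \<Rightarrow> 'o \<Rightarrow> 'm \<Rightarrow> 'm" where
  "lin1 X L C A B E f =
     (let S = C \<otimes>\<^bsub>X\<^esub> (A \<otimes>\<^bsub>X\<^esub> B); T = (C \<otimes>\<^bsub>X\<^esub> A) \<otimes>\<^bsub>X\<^esub> B; a = alpha X C A B
      in comp X S T E a (L (C \<otimes>\<^bsub>X\<^esub> A) B E (comp X T S E (inverse_arr X S T a) f)))"

text \<open>
  \<open>L C A B\<close> is the operator of index \<open>C\<close> on the hom-set from \<open>C \<otimes> A\<close> to \<open>B\<close>. In the zero part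
  of axiom L2, and in \<open>\<langle>\<pi>\<^sub>0,0\<rangle>\<close> in L5, the domain of \<open>\<langle>\<pi>\<^sub>0,0\<rangle>\<close> is the one forced by
  composition in the simple slice: it is \<open>C \<otimes> Z\<close> with \<open>Z\<close> arbitrary in L2, and \<open>C \<otimes> B\<close> in L5.
\<close>

locale linearizing_system = cartesian_left_additive_category X
  for X :: "('o, 'm, 'z) cart_add_cat_scheme" (structure) +
  fixes L :: "'o \<Rightarrow> 'o \<Rightarrow> 'o \<Rightarrow> 'm \<Rightarrow> 'm"
  assumes L_in_hom: "f \<in> hom X (C \<otimes> A) B \<Longrightarrow> L C A B f \<in> hom X (C \<otimes> A) B"
    and L1_plus: "\<lbrakk>f \<in> hom X (C \<otimes> A) B; g \<in> hom X (C \<otimes> A) B\<rbrakk>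
      \<Longrightarrow> L C A B (plus_arr X (C \<otimes> A) B f g) = plus_arr X (C \<otimes> A) B (L C A B f) (L C A B g)"
    and L1_zero: "L C A B (zero_arr X (C \<otimes> A) B) = zero_arr X (C \<otimes> A) B"
    and L2_plus: "f \<in> hom X (C \<otimes> A) B
      \<Longrightarrow> comp X (C \<otimes> (A \<otimes> A)) (C \<otimes> A) B (cross X C C (A \<otimes> A) A (ident X C) (oplus X A)) (L C A B f)
          = plus_arr X (C \<otimes> (A \<otimes> A)) B
              (comp X (C \<otimes> (A \<otimes> A)) (C \<otimes> A) B
                 (cross X C C (A \<otimes> A) A (ident X C) (proj0 X A A)) (L C A B f))
              (comp X (C \<otimes> (A \<otimes> A)) (C \<otimes> A) B
                 (cross X C C (A \<otimes> A) A (ident X C) (proj1 X A A)) (L C A B f))"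
    and L2_zero: "f \<in> hom X (C \<otimes> A) B
      \<Longrightarrow> comp X (C \<otimes> Z) (C \<otimes> A) B
            (pair X (C \<otimes> Z) C A (proj0 X C Z) (zero_arr X (C \<otimes> Z) A)) (L C A B f)
          = zero_arr X (C \<otimes> Z) B"
    and L3_ident: "L C A A (proj1 X C A) = proj1 X C A"
    and L3_proj0: "L C (A \<otimes> B) A (comp X (C \<otimes> (A \<otimes> B)) (A \<otimes> B) A (proj1 X C (A \<otimes> B)) (proj0 X A B))
      = comp X (C \<otimes> (A \<otimes> B)) (A \<otimes> B) A (proj1 X C (A \<otimes> B)) (proj0 X A B)"
    and L3_proj1: "L C (A \<otimes> B) B (comp X (C \<otimes> (A \<otimes> B)) (A \<otimes> B) B (proj1 X C (A \<otimes> B)) (proj1 X A B))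
      = comp X (C \<otimes> (A \<otimes> B)) (A \<otimes> B) B (proj1 X C (A \<otimes> B)) (proj1 X A B)"
    and L4: "\<lbrakk>f \<in> hom X (C \<otimes> Z) A; g \<in> hom X (C \<otimes> Z) B\<rbrakk>
      \<Longrightarrow> L C Z (A \<otimes> B) (pair X (C \<otimes> Z) A B f g) = pair X (C \<otimes> Z) A B (L C Z A f) (L C Z B g)"
    and L5: "\<lbrakk>f \<in> hom X (C \<otimes> A) B; g \<in> hom X (C \<otimes> B) E\<rbrakk>
      \<Longrightarrow> L C A E (comp X (C \<otimes> A) (C \<otimes> B) E (pair X (C \<otimes> A) C B (proj0 X C A) f) g)
          = comp X (C \<otimes> A) (C \<otimes> B) E
              (pair X (C \<otimes> A) C B (proj0 X C A) (L C A B f))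
              (L C B E
                 (comp X (C \<otimes> B) (C \<otimes> B) E
                    (pair X (C \<otimes> B) C B (proj0 X C B)
                       (plus_arr X (C \<otimes> B) B (proj1 X C B)
                          (comp X (C \<otimes> B) (C \<otimes> A) B
                             (pair X (C \<otimes> B) C A (proj0 X C B) (zero_arr X (C \<otimes> B) A)) f)))
                    g))"
    and L6: "f \<in> hom X (C \<otimes> A) B \<Longrightarrow> L C A B (L C A B f) = L C A B f"
    and L7: "f \<in> hom X (C \<otimes> (A \<otimes> B)) E
      \<Longrightarrow> lin1 X L C A B E (lin0 X L C A B E f) = lin0 X L C A B E (lin1 X L C A B E f)"
    and L8: "\<lbrakk>h \<in> hom X C' C; f \<in> hom X (C \<otimes> A) B\<rbrakk>
      \<Longrightarrow> comp X (C' \<otimes> A) (C \<otimes> A) B (cross X C' C A A h (ident X A)) (L C A B f)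
          = L C' A B (comp X (C' \<otimes> A) (C \<otimes> A) B (cross X C' C A A h (ident X A)) f)"

text \<open>The combinator on the base category obtained from a system at the terminal object.\<close>

definition lin_of_system ::
  "('o, 'm, 'z) cart_add_cat_scheme \<Rightarrow> ('o \<Rightarrow> 'o \<Rightarrow> 'o \<Rightarrow> 'm \<Rightarrow> 'm) \<Rightarrow> 'o \<Rightarrow> 'o \<Rightarrow> 'm \<Rightarrow> 'm" where
  "lin_of_system X L A B f =
     comp X A (top_ob X \<otimes>\<^bsub>X\<^esub> A) B (inr X (top_ob X) A)
       (L (top_ob X) A B (comp X (top_ob X \<otimes>\<^bsub>X\<^esub> A) A B (proj1 X (top_ob X) A) f))"

end

theory Submission
  imports Defs
begin

text \<open>
  Everything is computed at generalized elements. For \<open>f : A \<rightarrow> B\<close> and \<open>x, v : Z \<rightarrow> A\<close> write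
  \<open>f'(x; v) = \<langle>x,v\<rangle> D[f]\<close>, the derivative of \<open>f\<close> at \<open>x\<close> in the direction \<open>v\<close>. In these terms
  \<open>L\<^sup>C[f](c, a) = f'((c,0); (0,a))\<close>: differentiate at \<open>a = 0\<close>, in the direction of \<open>a\<close> alone.

  Most of the axioms are then direct computations. Additivity in \<open>a\<close> is additivity of the derivative
  in its direction. The chain rule L5 is CD5, where the summand \<open>f(c,0)\<close> appears because the
  derivative of \<open>g(c, f(c,a))\<close> is taken at \<open>a = 0\<close> whereas linearizing \<open>g\<close> alone would take it at
  \<open>b = 0\<close>; translating \<open>g\<close> by \<open>f(c,0)\<close> moves the base point. Reindexing L8 holds because the
  derivative of \<open>h \<times> 1\<close> in a direction \<open>(0,a)\<close> is again \<open>(0,a)\<close>.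

  The content lies in the second derivative. From CD2, CD6 and CD7 one gets
  \<open>(D[f])'((x,y); (0,v)) = f'(x; v)\<close> (\<open>second_deriv_at_linear\<close>), which says that \<open>D[f]\<close> is linear in
  its direction. Since \<open>L\<^sup>C[f]\<close> is \<open>D[f]\<close> after a map that puts \<open>a\<close> in the direction slot, this makes
  \<open>L\<^sup>C[f]\<close> linear in its second argument; idempotence L6 and the description of the linear maps as
  the fixed points of \<open>L\<^sup>C\<close> follow. Finally, both iterated partial linearizations of
  \<open>f : C \<times> (A \<times> B) \<rightarrow> E\<close> are second derivatives of \<open>f\<close> at \<open>(c,(0,0))\<close> in the two directions
  \<open>(0,(a,0))\<close> and \<open>(0,(0,b))\<close>, so L7 is the symmetry of the second derivative CD7.
\<close>

section \<open>Normalizing arrows between products\<close>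

context cartesian_left_additive_category
begin

lemmas arrow_in_hom =
  ident_in_hom comp_in_hom zero_in_hom plus_in_hom proj0_in_hom proj1_in_hom pair_in_hom

text \<open>
  The lemmas of this section are oriented so that rewriting from left to right moves composition
  inside tuples and cancels projections, so that equal composites of structural arrows become
  syntactically equal. Each composition carries its three objects, so the simplifier can
  discharge the membership conditions structurally.
\<close>

lemma pair_eqI:
  assumes "h \<in> hom X Z (A \<otimes> B)"
    and "comp X Z (A \<otimes> B) A h (proj0 X A B) = f"
    and "comp X Z (A \<otimes> B) B h (proj1 X A B) = g"
  shows "h = pair X Z A B f g"
  using pair_unique[OF assms(1)] assms(2,3) by simp

lemma comp_pair:
  assumes "h \<in> hom X W Z" "f \<in> hom X Z A" "g \<in> hom X Z B"
  shows "comp X W Z (A \<otimes> B) h (pair X Z A B f g)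
       = pair X W A B (comp X W Z A h f) (comp X W Z B h g)"
  by (rule pair_eqI) (simp_all add: assms arrow_in_hom comp_assoc pair_proj0 pair_proj1)

text \<open>
  Composites are kept associated to the right, where \<open>comp_pair\<close> alone no longer sees its redex; this
  form also acts when the pair is followed by another arrow, and the next two lemmas do the same for
  the projection equations.
\<close>

lemma comp_pair_comp:
  assumes "h \<in> hom X W Z" "f \<in> hom X Z A" "g \<in> hom X Z B" "k \<in> hom X (A \<otimes> B) E"
  shows "comp X W Z E h (comp X Z (A \<otimes> B) E (pair X Z A B f g) k)
       = comp X W (A \<otimes> B) E (pair X W A B (comp X W Z A h f) (comp X W Z B h g)) k"
  using comp_assoc[OF assms(1) pair_in_hom[OF assms(2,3)] assms(4)] comp_pair[OF assms(1-3)]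
  by simp

lemma pair_proj0_comp:
  assumes "f \<in> hom X Z A" "g \<in> hom X Z B" "h \<in> hom X A E"
  shows "comp X Z (A \<otimes> B) E (pair X Z A B f g) (comp X (A \<otimes> B) A E (proj0 X A B) h)
       = comp X Z A E f h"
  using comp_assoc[OF pair_in_hom[OF assms(1,2)] proj0_in_hom assms(3)] assms
  by (simp add: pair_proj0)

lemma pair_proj1_comp:
  assumes "f \<in> hom X Z A" "g \<in> hom X Z B" "h \<in> hom X B E"
  shows "comp X Z (A \<otimes> B) E (pair X Z A B f g) (comp X (A \<otimes> B) B E (proj1 X A B) h)
       = comp X Z B E g h"
  using comp_assoc[OF pair_in_hom[OF assms(1,2)] proj1_in_hom assms(3)] assms
  by (simp add: pair_proj1)

text \<open>
  Additivity is known only for the projections. A tuple of zeros or of sums is nevertheless a zero or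
  a sum, since that can be tested on the projections.
\<close>

lemma zero_proj:
  "comp X Z (A \<otimes> B) A (zero_arr X Z (A \<otimes> B)) (proj0 X A B) = zero_arr X Z A"
  "comp X Z (A \<otimes> B) B (zero_arr X Z (A \<otimes> B)) (proj1 X A B) = zero_arr X Z B"
  using proj0_additive[of A B] proj1_additive[of A B] by (auto simp: additive_def)

lemma plus_proj:
  assumes "g \<in> hom X Z (A \<otimes> B)" "h \<in> hom X Z (A \<otimes> B)"
  shows "comp X Z (A \<otimes> B) A (plus_arr X Z (A \<otimes> B) g h) (proj0 X A B)
       = plus_arr X Z A (comp X Z (A \<otimes> B) A g (proj0 X A B)) (comp X Z (A \<otimes> B) A h (proj0 X A B))"
    and "comp X Z (A \<otimes> B) B (plus_arr X Z (A \<otimes> B) g h) (proj1 X A B)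
       = plus_arr X Z B (comp X Z (A \<otimes> B) B g (proj1 X A B)) (comp X Z (A \<otimes> B) B h (proj1 X A B))"
  using proj0_additive[of A B] proj1_additive[of A B] assms by (auto simp: additive_def)

lemma pair_zero:
  "pair X Z A B (zero_arr X Z A) (zero_arr X Z B) = zero_arr X Z (A \<otimes> B)"
  by (rule pair_eqI[symmetric]) (simp_all add: zero_in_hom zero_proj)

lemma pair_plus:
  assumes "f \<in> hom X Z A" "g \<in> hom X Z B" "f' \<in> hom X Z A" "g' \<in> hom X Z B"
  shows "plus_arr X Z (A \<otimes> B) (pair X Z A B f g) (pair X Z A B f' g')
       = pair X Z A B (plus_arr X Z A f f') (plus_arr X Z B g g')"
  by (rule pair_eqI) (simp_all add: assms arrow_in_hom plus_proj pair_proj0 pair_proj1)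

lemma pair_proj_ident:
  "pair X (A \<otimes> B) A B (proj0 X A B) (proj1 X A B) = ident X (A \<otimes> B)"
  by (rule pair_eqI[symmetric]) (simp_all add: arrow_in_hom comp_ident_left)

lemma zero_plus: "f \<in> hom X A B \<Longrightarrow> plus_arr X A B (zero_arr X A B) f = f"
  using plus_comm[of f A B "zero_arr X A B"] by (simp add: zero_in_hom plus_zero)

lemmas cartesian_normalize =
  arrow_in_hom comp_ident_left comp_ident_right comp_assoc comp_plus comp_zero plus_zero zero_plus
  pair_proj0 pair_proj1 pair_proj0_comp pair_proj1_comp comp_pair comp_pair_comp zero_proj
  plus_proj pair_zero pair_proj_ident pair_unique

lemmas arrow_defs = cross_def inl_def inr_def oplus_def ell_def interchange_def

text \<open>
  \<open>inverse_arr\<close> is a definite description, so an explicit inverse becomes usable only through the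
  uniqueness of inverses.
\<close>

lemma inverse_arr_eqI:
  assumes f: "f \<in> hom X A B" and g: "is_inverse X A B f g"
  shows "inverse_arr X A B f = g"
  unfolding inverse_arr_def
proof (rule the_equality[where P = "is_inverse X A B f", OF g])
  fix g' assume g': "is_inverse X A B f g'"
  have hom: "g \<in> hom X B A" "g' \<in> hom X B A"
    using g g' by (simp_all add: is_inverse_def)
  have "comp X B A A g' (comp X A B A f g) = comp X B B A (comp X B A B g' f) g"
    by (rule comp_assoc[symmetric]) (fact hom f)+
  with hom show "g' = g"
    using g g' by (simp add: is_inverse_def comp_ident_left comp_ident_right)
qed

lemma inverse_alpha:
  "inverse_arr X (C \<otimes> (A \<otimes> B)) ((C \<otimes> A) \<otimes> B) (alpha X C A B)
   = (let T = (C \<otimes> A) \<otimes> B; p = proj0 X (C \<otimes> A) B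
      in pair X T C (A \<otimes> B)
           (comp X T (C \<otimes> A) C p (proj0 X C A))
           (pair X T A B (comp X T (C \<otimes> A) A p (proj1 X C A)) (proj1 X (C \<otimes> A) B)))"
  by (rule inverse_arr_eqI)
    (simp_all add: Let_def is_inverse_def alpha_def arrow_defs cartesian_normalize)

lemma inverse_beta:
  "inverse_arr X (C \<otimes> (A \<otimes> B)) ((C \<otimes> B) \<otimes> A) (beta X C A B)
   = (let T = (C \<otimes> B) \<otimes> A; p = proj0 X (C \<otimes> B) A
      in pair X T C (A \<otimes> B)
           (comp X T (C \<otimes> B) C p (proj0 X C B))
           (pair X T A B (proj1 X (C \<otimes> B) A) (comp X T (C \<otimes> B) B p (proj1 X C B))))"
  by (rule inverse_arr_eqI)
    (simp_all add: Let_def is_inverse_def beta_def arrow_defs cartesian_normalize)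

end

section \<open>Derivatives at generalized elements\<close>

context cartesian_differential_category
begin

abbreviation deriv_at :: "'o \<Rightarrow> 'o \<Rightarrow> 'o \<Rightarrow> 'm \<Rightarrow> 'm \<Rightarrow> 'm \<Rightarrow> 'm" where
  "deriv_at Z A B f x v \<equiv> comp X Z (A \<otimes> A) B (pair X Z A A x v) (D A B f)"

text \<open>
  The axioms CD2, CD6 and CD7 are equations between arrows out of \<open>A\<close> or products of copies of \<open>A\<close>.
  Precomposing with generalized elements turns them into equations about \<open>deriv_at\<close>, which
  simplification can apply to arbitrary arguments.
\<close>

lemma deriv_at_zero:
  assumes "f \<in> hom X A B" "x \<in> hom X Z A"
  shows "deriv_at Z A B f x (zero_arr X Z A) = zero_arr X Z B"
proof -
  have "comp X Z A B x (comp X A (A \<otimes> A) B (inl X A A) (D A B f)) = zero_arr X Z B"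
    using assms by (simp add: CD2_zero comp_zero)
  then show ?thesis
    using assms
    by (simp add: arrow_defs cartesian_normalize D_in_hom)
qed

lemma deriv_at_plus:
  assumes "f \<in> hom X A B" "x \<in> hom X Z A" "v \<in> hom X Z A" "w \<in> hom X Z A"
  shows "deriv_at Z A B f x (plus_arr X Z A v w)
       = plus_arr X Z B (deriv_at Z A B f x v) (deriv_at Z A B f x w)"
proof -
  let ?xvw = "pair X Z A (A \<otimes> A) x (pair X Z A A v w)"
  have "?xvw \<in> hom X Z (A \<otimes> (A \<otimes> A))"
    using assms by (simp add: arrow_in_hom)
  then show ?thesis
    using arg_cong[OF CD2_plus[OF assms(1)], of "comp X Z (A \<otimes> (A \<otimes> A)) B ?xvw"] assms
    by (simp add: arrow_defs cartesian_normalize D_in_hom)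
qed

lemma second_deriv_at_diagonal:
  assumes "f \<in> hom X A B" "x \<in> hom X Z A" "v \<in> hom X Z A"
  shows "deriv_at Z (A \<otimes> A) B (D A B f)
           (pair X Z A A x (zero_arr X Z A)) (pair X Z A A (zero_arr X Z A) v)
       = deriv_at Z A B f x v"
  using arg_cong[OF CD6[OF assms(1)], of "comp X Z (A \<otimes> A) B (pair X Z A A x v)"] assms
  by (simp add: arrow_defs cartesian_normalize D_in_hom)

lemma second_deriv_at_swap:
  assumes "f \<in> hom X A B" "x \<in> hom X Z A" "y \<in> hom X Z A" "u \<in> hom X Z A" "v \<in> hom X Z A"
  shows "deriv_at Z (A \<otimes> A) B (D A B f) (pair X Z A A x y) (pair X Z A A u v)
       = deriv_at Z (A \<otimes> A) B (D A B f) (pair X Z A A x u) (pair X Z A A y v)"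
  using arg_cong[OF CD7[OF assms(1)], of "comp X Z ((A \<otimes> A) \<otimes> (A \<otimes> A)) B
      (pair X Z (A \<otimes> A) (A \<otimes> A) (pair X Z A A x u) (pair X Z A A y v))"] assms
  by (simp add: arrow_defs cartesian_normalize D_in_hom)

text \<open>
  \<open>D[f]\<close> is linear in its direction argument. By CD7 the entries \<open>y\<close> and \<open>0\<close> may be exchanged, so the
  derivative is taken at \<open>(x,0)\<close> in the direction \<open>(y,v) = (y,0) + (0,v)\<close>. The summand for \<open>(0,v)\<close> is
  \<open>f'(x; v)\<close> by CD6; the one for \<open>(y,0)\<close> is, exchanging back, a derivative in the direction \<open>(0,0)\<close>
  and vanishes.
\<close>

lemma second_deriv_at_linear:
  assumes "f \<in> hom X A B" "x \<in> hom X Z A" "y \<in> hom X Z A" "v \<in> hom X Z A"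
  shows "deriv_at Z (A \<otimes> A) B (D A B f) (pair X Z A A x y) (pair X Z A A (zero_arr X Z A) v)
       = deriv_at Z A B f x v"
proof -
  let ?o = "zero_arr X Z A"
  let ?DD = "deriv_at Z (A \<otimes> A) B (D A B f)"
  have "?DD (pair X Z A A x y) (pair X Z A A ?o v) = ?DD (pair X Z A A x ?o) (pair X Z A A y v)"
    using assms by (intro second_deriv_at_swap) (simp_all add: arrow_in_hom)
  also have "pair X Z A A y v = plus_arr X Z (A \<otimes> A) (pair X Z A A y ?o) (pair X Z A A ?o v)"
    using assms by (simp add: pair_plus cartesian_normalize)
  also have "?DD (pair X Z A A x ?o) \<dots> = plus_arr X Z B
      (?DD (pair X Z A A x ?o) (pair X Z A A y ?o)) (?DD (pair X Z A A x ?o) (pair X Z A A ?o v))"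
    using assms by (intro deriv_at_plus) (simp_all add: arrow_in_hom D_in_hom)
  also have "?DD (pair X Z A A x ?o) (pair X Z A A y ?o)
      = ?DD (pair X Z A A x y) (pair X Z A A ?o ?o)"
    using assms by (intro second_deriv_at_swap) (simp_all add: arrow_in_hom)
  also have "\<dots> = zero_arr X Z B"
    using assms by (simp add: pair_zero deriv_at_zero arrow_in_hom D_in_hom)
  also have "?DD (pair X Z A A x ?o) (pair X Z A A ?o v) = deriv_at Z A B f x v"
    using assms by (intro second_deriv_at_diagonal)
  finally show ?thesis
    using assms by (simp add: zero_plus arrow_in_hom D_in_hom)
qed

text \<open>
  The case \<open>x = v = 0\<close> of \<open>deriv_at_zero\<close> in normal form, where the pair \<open>\<langle>0,0\<rangle>\<close> has collapsed to \<open>0\<close>.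
\<close>

lemma zero_comp_deriv:
  assumes "f \<in> hom X A B"
  shows "comp X Z (A \<otimes> A) B (zero_arr X Z (A \<otimes> A)) (D A B f) = zero_arr X Z B"
  using deriv_at_zero[OF assms zero_in_hom[of Z A]] by (simp add: pair_zero)

lemmas deriv_normalize =
  cartesian_normalize D_in_hom CD1_plus CD1_zero CD3_ident CD3_proj0 CD3_proj1 CD4 CD5
  deriv_at_zero zero_comp_deriv

section \<open>Linearization in the second argument\<close>

text \<open>
  In terms of elements, \<open>D\<^sup>C[f](c,(a,v)) = f'((c,a); (0,v))\<close>: the context is held constant.
\<close>

lemma slice_diff_eq_deriv_at:
  assumes "f \<in> hom X (C \<otimes> A) B"
  shows "slice_diff X D C A B f
    = (let S = C \<otimes> (A \<otimes> A); p = proj1 X C (A \<otimes> A)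
       in deriv_at S (C \<otimes> A) B f
            (pair X S C A (proj0 X C (A \<otimes> A)) (comp X S (A \<otimes> A) A p (proj0 X A A)))
            (pair X S C A (zero_arr X S C) (comp X S (A \<otimes> A) A p (proj1 X A A))))"
  using assms by (simp add: slice_diff_def arrow_defs deriv_normalize Let_def)

lemma slice_lin_eq_deriv_at:
  assumes "f \<in> hom X (C \<otimes> A) B"
  shows "slice_lin X D C A B f = deriv_at (C \<otimes> A) (C \<otimes> A) B f
    (pair X (C \<otimes> A) C A (proj0 X C A) (zero_arr X (C \<otimes> A) A))
    (pair X (C \<otimes> A) C A (zero_arr X (C \<otimes> A) C) (proj1 X C A))"
  using assms
  by (simp add: slice_lin_def lin_of_diff_def slice_def slice_diff_eq_deriv_at arrow_defs
      deriv_normalize Let_def)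

lemma slice_lin_in_hom:
  assumes "f \<in> hom X (C \<otimes> A) B"
  shows "slice_lin X D C A B f \<in> hom X (C \<otimes> A) B"
  using assms by (simp add: slice_lin_eq_deriv_at arrow_in_hom D_in_hom)

lemma slice_lin_eq_ell:
  assumes "f \<in> hom X (C \<otimes> A) B"
  shows "slice_lin X D C A B f
    = comp X (C \<otimes> A) ((C \<otimes> A) \<otimes> (C \<otimes> A)) B (ell X C A C A) (D (C \<otimes> A) B f)"
  using assms by (simp add: slice_lin_eq_deriv_at arrow_defs deriv_normalize)

text \<open>
  The element form \<open>L\<^sup>C[f](c,a) = f'((c,0); (0,a))\<close> on which the later computations rest.
\<close>

lemma slice_lin_at:
  assumes "f \<in> hom X (C \<otimes> A) B" "c \<in> hom X Z C" "a \<in> hom X Z A"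
  shows "comp X Z (C \<otimes> A) B (pair X Z C A c a) (slice_lin X D C A B f)
    = deriv_at Z (C \<otimes> A) B f
        (pair X Z C A c (zero_arr X Z A)) (pair X Z C A (zero_arr X Z C) a)"
  using assms
  by (simp add: slice_lin_eq_deriv_at cartesian_normalize D_in_hom)

text \<open>
  \<open>L\<^sup>C[f]\<close> is \<open>D[f]\<close> after the map \<open>(c,a) \<mapsto> ((c,0),(0,a))\<close>. This map is built from projections and
  zeros, hence equals its own derivative in every direction, and so it acts on the base point and on
  the direction alike.
\<close>

lemma deriv_slice_lin_at:
  assumes "f \<in> hom X (C \<otimes> A) B"
    and "c \<in> hom X Z C" "a \<in> hom X Z A" "u \<in> hom X Z C" "v \<in> hom X Z A"
  shows "deriv_at Z (C \<otimes> A) B (slice_lin X D C A B f) (pair X Z C A c a) (pair X Z C A u v)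
    = (let c0 = pair X Z C A c (zero_arr X Z A); a0 = pair X Z C A (zero_arr X Z C) a;
           u0 = pair X Z C A u (zero_arr X Z A); v0 = pair X Z C A (zero_arr X Z C) v
       in deriv_at Z ((C \<otimes> A) \<otimes> (C \<otimes> A)) B (D (C \<otimes> A) B f)
            (pair X Z (C \<otimes> A) (C \<otimes> A) c0 a0) (pair X Z (C \<otimes> A) (C \<otimes> A) u0 v0))"
  using assms by (simp add: slice_lin_eq_deriv_at deriv_normalize Let_def)

text \<open>
  At \<open>(c,(a,v))\<close> the derivative of \<open>L\<^sup>C[f]\<close> is \<open>(D[f])'(((c,0),(0,a)); (0,(0,v)))\<close>. By
  \<open>second_deriv_at_linear\<close> the entry \<open>(0,a)\<close> drops out and leaves \<open>f'((c,0); (0,v))\<close>.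
\<close>

theorem slice_lin_linear_in_second:
  assumes "f \<in> hom X (C \<otimes> A) B"
  shows "linear_in_second X D C A B (slice_lin X D C A B f)"
  unfolding linear_in_second_def using assms
  by (simp add: slice_diff_eq_deriv_at slice_lin_in_hom deriv_slice_lin_at slice_lin_at arrow_defs
      second_deriv_at_linear deriv_normalize Let_def)

theorem slice_lin_idem:
  assumes "f \<in> hom X (C \<otimes> A) B"
  shows "slice_lin X D C A B (slice_lin X D C A B f) = slice_lin X D C A B f"
  using assms
  by (simp add: slice_lin_eq_deriv_at[OF slice_lin_in_hom] deriv_slice_lin_at
      second_deriv_at_linear deriv_normalize Let_def)
    (simp add: slice_lin_eq_deriv_at)

text \<open>
  A fixed point is linear because it lies in the image of \<open>L\<^sup>C\<close>. Conversely, precomposing the linearity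
  equation with \<open>(c,a) \<mapsto> (c,(0,a))\<close> turns its left side into \<open>L\<^sup>C[f]\<close> by definition, and its right side
  into \<open>f\<close>.
\<close>

theorem linear_in_second_iff_slice_lin_fixed:
  assumes f: "f \<in> hom X (C \<otimes> A) B"
  shows "linear_in_second X D C A B f \<longleftrightarrow> slice_lin X D C A B f = f"
proof
  assume "slice_lin X D C A B f = f"
  then show "linear_in_second X D C A B f"
    using slice_lin_linear_in_second[OF f] by simp
next
  assume lin: "linear_in_second X D C A B f"
  then show "slice_lin X D C A B f = f"
    using f unfolding linear_in_second_def
    by (simp add: slice_lin_def lin_of_diff_def slice_def arrow_defs)
      (simp add: cartesian_normalize)
qed

section \<open>The system of linearizing combinators\<close>

text \<open>
  \<open>(0, a + a') = (0,a) + (0,a')\<close>, and a derivative is additive in its direction.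
\<close>

lemma slice_lin_plus_argument:
  assumes "f \<in> hom X (C \<otimes> A) B" "c \<in> hom X Z C" "a \<in> hom X Z A" "a' \<in> hom X Z A"
  shows "comp X Z (C \<otimes> A) B (pair X Z C A c (plus_arr X Z A a a')) (slice_lin X D C A B f)
    = plus_arr X Z B
        (comp X Z (C \<otimes> A) B (pair X Z C A c a) (slice_lin X D C A B f))
        (comp X Z (C \<otimes> A) B (pair X Z C A c a') (slice_lin X D C A B f))"
proof -
  let ?o = "zero_arr X Z C"
  have "pair X Z C A ?o (plus_arr X Z A a a')
      = plus_arr X Z (C \<otimes> A) (pair X Z C A ?o a) (pair X Z C A ?o a')"
    using assms by (simp add: pair_plus cartesian_normalize)
  then show ?thesis
    using assms by (simp add: slice_lin_at deriv_at_plus arrow_in_hom)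
qed

text \<open>
  By the chain rule the left side at \<open>(c,a)\<close> is \<open>g'((c, f(c,0)); (0, L\<^sup>C[f](c,a)))\<close>. The linearization
  on the right takes the derivative of \<open>(c,b) \<mapsto> g(c, b + f(c,0))\<close> at \<open>b = 0\<close> with \<open>c\<close> held
  constant; there \<open>f(c,0)\<close> shifts the base point of \<open>g\<close> but contributes nothing to the direction.
\<close>

theorem slice_lin_chain:
  assumes "f \<in> hom X (C \<otimes> A) B" "g \<in> hom X (C \<otimes> B) E"
  shows "slice_lin X D C A E (comp X (C \<otimes> A) (C \<otimes> B) E (pair X (C \<otimes> A) C B (proj0 X C A) f) g)
          = comp X (C \<otimes> A) (C \<otimes> B) E
              (pair X (C \<otimes> A) C B (proj0 X C A) (slice_lin X D C A B f))
              (slice_lin X D C B E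
                 (comp X (C \<otimes> B) (C \<otimes> B) E
                    (pair X (C \<otimes> B) C B (proj0 X C B)
                       (plus_arr X (C \<otimes> B) B (proj1 X C B)
                          (comp X (C \<otimes> B) (C \<otimes> A) B
                             (pair X (C \<otimes> B) C A (proj0 X C B) (zero_arr X (C \<otimes> B) A)) f)))
                    g))"
  using assms
  by (simp add: slice_lin_at slice_lin_in_hom arrow_in_hom)
     (simp add: slice_lin_eq_deriv_at deriv_normalize)

text \<open>
  With the isomorphisms unwound, \<open>lin0\<close> maps \<open>f\<close> to \<open>(c,(a,b)) \<mapsto> f'((c,(0,b)); (0,(a,0)))\<close>, and \<open>lin1\<close>
  exchanges the roles of \<open>a\<close> and \<open>b\<close>.
\<close>

lemma lin0_eq_deriv_at:
  assumes "f \<in> hom X (C \<otimes> (A \<otimes> B)) E"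
  shows "lin0 X (slice_lin X D) C A B E f
    = (let S = C \<otimes> (A \<otimes> B); c = proj0 X C (A \<otimes> B); p = proj1 X C (A \<otimes> B);
           a = comp X S (A \<otimes> B) A p (proj0 X A B); b = comp X S (A \<otimes> B) B p (proj1 X A B)
       in deriv_at S S E f
            (pair X S C (A \<otimes> B) c (pair X S A B (zero_arr X S A) b))
            (pair X S C (A \<otimes> B) (zero_arr X S C) (pair X S A B a (zero_arr X S B))))"
  using assms unfolding lin0_def Let_def inverse_beta[unfolded Let_def]
  unfolding beta_def
  by (simp add: slice_lin_at arrow_defs deriv_normalize)

lemma lin1_eq_deriv_at:
  assumes "f \<in> hom X (C \<otimes> (A \<otimes> B)) E"
  shows "lin1 X (slice_lin X D) C A B E f
    = (let S = C \<otimes> (A \<otimes> B); c = proj0 X C (A \<otimes> B); p = proj1 X C (A \<otimes> B);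
           a = comp X S (A \<otimes> B) A p (proj0 X A B); b = comp X S (A \<otimes> B) B p (proj1 X A B)
       in deriv_at S S E f
            (pair X S C (A \<otimes> B) c (pair X S A B a (zero_arr X S B)))
            (pair X S C (A \<otimes> B) (zero_arr X S C) (pair X S A B (zero_arr X S A) b)))"
  using assms unfolding lin1_def Let_def inverse_alpha[unfolded Let_def]
  unfolding alpha_def
  by (simp add: slice_lin_at arrow_defs deriv_normalize)

text \<open>
  At \<open>(c,(a,b))\<close> the left side is \<open>(D[f])'((x,u); (w,0))\<close> with \<open>x = (c,(0,0))\<close>, \<open>u = (0,(a,0))\<close> and
  \<open>w = (0,(0,b))\<close>. The right side has \<open>u\<close> and \<open>w\<close> exchanged, so they agree by CD7.
\<close>

theorem lin0_lin1_commute: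
  assumes f: "f \<in> hom X (C \<otimes> (A \<otimes> B)) E"
  shows "lin1 X (slice_lin X D) C A B E (lin0 X (slice_lin X D) C A B E f)
       = lin0 X (slice_lin X D) C A B E (lin1 X (slice_lin X D) C A B E f)"
proof -
  have "lin0 X (slice_lin X D) C A B E f \<in> hom X (C \<otimes> (A \<otimes> B)) E"
    "lin1 X (slice_lin X D) C A B E f \<in> hom X (C \<otimes> (A \<otimes> B)) E"
    using f by (simp_all add: lin0_eq_deriv_at lin1_eq_deriv_at Let_def arrow_in_hom D_in_hom)
  then show ?thesis
    using f
    by (simp add: lin0_eq_deriv_at lin1_eq_deriv_at Let_def deriv_normalize)
      (intro second_deriv_at_swap; simp add: arrow_in_hom)
qed

text \<open>
  Pulling back along \<open>h\<close> replaces \<open>c\<close> by \<open>h(c)\<close> in the base point. In the direction, the context entry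
  becomes the derivative of \<open>h\<close> in the direction \<open>0\<close>, which is again \<open>0\<close>.
\<close>

theorem slice_lin_reindex:
  assumes "h \<in> hom X C' C" "f \<in> hom X (C \<otimes> A) B"
  shows "comp X (C' \<otimes> A) (C \<otimes> A) B (cross X C' C A A h (ident X A)) (slice_lin X D C A B f)
    = slice_lin X D C' A B (comp X (C' \<otimes> A) (C \<otimes> A) B (cross X C' C A A h (ident X A)) f)"
  using assms
  by (simp add: slice_lin_at slice_lin_eq_deriv_at[of "comp X _ _ _ _ _"] arrow_defs deriv_normalize)

theorem slice_lin_linearizing_system: "linearizing_system X (slice_lin X D)"
proof
  show "slice_lin X D C A B f \<in> hom X (C \<otimes> A) B" if "f \<in> hom X (C \<otimes> A) B" for f C A B
    using that by (rule slice_lin_in_hom)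
  show "lin1 X (slice_lin X D) C A B E (lin0 X (slice_lin X D) C A B E f)
       = lin0 X (slice_lin X D) C A B E (lin1 X (slice_lin X D) C A B E f)"
    if "f \<in> hom X (C \<otimes> (A \<otimes> B)) E" for f C A B E
    using that by (rule lin0_lin1_commute)
  show "comp X (C \<otimes> (A \<otimes> A)) (C \<otimes> A) B (cross X C C (A \<otimes> A) A (ident X C) (oplus X A))
          (slice_lin X D C A B f)
      = plus_arr X (C \<otimes> (A \<otimes> A)) B
          (comp X (C \<otimes> (A \<otimes> A)) (C \<otimes> A) B
             (cross X C C (A \<otimes> A) A (ident X C) (proj0 X A A)) (slice_lin X D C A B f))
          (comp X (C \<otimes> (A \<otimes> A)) (C \<otimes> A) B
             (cross X C C (A \<otimes> A) A (ident X C) (proj1 X A A)) (slice_lin X D C A B f))"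
    if "f \<in> hom X (C \<otimes> A) B" for f C A B
    using that by (simp add: arrow_defs cartesian_normalize slice_lin_plus_argument)
qed (simp_all add: slice_lin_idem slice_lin_chain slice_lin_reindex,
     simp_all add: slice_lin_at slice_lin_eq_deriv_at arrow_defs deriv_normalize)

text \<open>
  Under \<open>\<langle>0,1\<rangle>\<close> the context is the zero element of the terminal object, and the derivative of \<open>\<pi>\<^sub>1 f\<close>
  sees only second components: \<open>(\<pi>\<^sub>1 f)'((0,0); (0,a)) = f'(0; a)\<close>.
\<close>

theorem lin_of_system_slice_lin:
  assumes "f \<in> hom X A B"
  shows "lin_of_system X (slice_lin X D) A B f = lin_of_diff X D A B f"
  using assms
  by (simp add: lin_of_system_def lin_of_diff_def slice_lin_at arrow_defs deriv_normalize)

end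

theorem proposition5p5:
  fixes X :: "('o, 'm) cart_add_cat" (structure)
    and D :: "'o \<Rightarrow> 'o \<Rightarrow> 'm \<Rightarrow> 'm"
  assumes "cartesian_differential_category X D"
  shows "linearizing_system X (slice_lin X D)
    \<and> (\<forall>C A B. \<forall>f \<in> hom X (C \<otimes> A) B.
         slice_lin X D C A B f
         = comp X (C \<otimes> A) ((C \<otimes> A) \<otimes> (C \<otimes> A)) B (ell X C A C A) (D (C \<otimes> A) B f))
    \<and> (\<forall>C A B. \<forall>f \<in> hom X (C \<otimes> A) B.
         linear_in_second X D C A B (slice_lin X D C A B f))
    \<and> (\<forall>C A B. \<forall>f \<in> hom X (C \<otimes> A) B.
         linear_in_second X D C A B f \<longleftrightarrow> slice_lin X D C A B f = f)
    \<and> (\<forall>A B. \<forall>f \<in> hom X A B.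
         lin_of_system X (slice_lin X D) A B f = lin_of_diff X D A B f)"
proof -
  interpret cartesian_differential_category X D by fact
  show ?thesis
    by (intro conjI allI ballI slice_lin_linearizing_system slice_lin_eq_ell
        slice_lin_linear_in_second linear_in_second_iff_slice_lin_fixed lin_of_system_slice_lin)
qed

end
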